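(* Let $k:\mathbb{R}^2\to\mathbb{R}$ be an even, measurable function with $\int_{\mathbb{R}^2}k(\zeta)\,d\zeta=1$, and suppose there are constants $M_0\ge m_0>0$ and $R_0\ge r_0>0$ such that $m_0\,\chi_{B_{r_0}}(\zeta)\le k(\zeta)\le M_0\,\chi_{B_{R_0}}(\zeta)$ for every $\zeta\in\mathbb{R}^2$. For a function $w:\mathbb{R}^2\to\mathbb{R}$ write $$\mathcal{L}w(x):=\int_{\mathbb{R}^2}\big(w(x)-w(y)\big)\,k(x-y)\,dy .$$ Let $f\in C^1(\mathbb{R})$ and let $u:\mathbb{R}^2\to\mathbb{R}$ be a $C^1$ function with $\|u\|_{C^1(\mathbb{R}^2)}<+\infty$ which satisfies $\mathcal{L}u(x)=f\big(u(x)\big)$ for every $x\in\mathbb{R}^2$. Assume that there exists a function $\psi:\mathbb{R}^2\to\mathbb{R}$ with $\psi(x)>0$ for every $x\in\mathbb{R}^2$ which solves $$\mathcal{L}\psi(x)=f'\big(u(x)\big)\,\psi(x)\qquad\text{for every }x\in\mathbb{R}^2.$$ Then $u$ is one-dimensional, i.e. there exist a function $u_\star:\mathbb{R}\to\mathbb{R}$ and a vector $\omega\in\mathbb{R}^2$ such that $u(x)=u_\star(\omega\cdot x)$ for every $x\in\mathbb{R}^2$.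
   Context: $B_r$ denotes the ball of radius $r$ centered at the origin of $\mathbb{R}^2$, and $\chi_A$ is the characteristic function of the set $A$. A function $k$ is even if $k(-\zeta)=k(\zeta)$ for all $\zeta$. The norm $\|u\|_{C^1(\mathbb{R}^2)}<+\infty$ means that $u$ is continuously differentiable and that $u$ and its first partial derivatives are bounded on $\mathbb{R}^2$. That $\psi$ solves its equation includes that $\psi$ is measurable and that the integral defining $\mathcal{L}\psi(x)$ converges absolutely (i.e. is a well-defined finite Lebesgue integral) for every $x\in\mathbb{R}^2$. *)

theory Defs
  imports "HOL-Analysis.Analysis"
begin

text \<open>Where the integrand is not integrable the Bochner integral is 0 by convention, so
  absolute convergence has to be required separately wherever it is not automatic.\<close>

definition nonlocal_op :: "(real^2 \<Rightarrow> real) \<Rightarrow> (real^2 \<Rightarrow> real) \<Rightarrow> real^2 \<Rightarrow> real" where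
  "nonlocal_op k w x = (LINT y|lebesgue. (w x - w y) * k (x - y))"

definition partial_deriv :: "2 \<Rightarrow> (real^2 \<Rightarrow> real) \<Rightarrow> real^2 \<Rightarrow> real" where
  "partial_deriv i u x = frechet_derivative u (at x) (axis i 1)"

definition C1_plane :: "(real^2 \<Rightarrow> real) \<Rightarrow> bool" where
  "C1_plane u \<longleftrightarrow>
     (\<forall>x. u differentiable (at x)) \<and> (\<forall>i. continuous_on UNIV (partial_deriv i u))"

definition finite_C1_norm :: "(real^2 \<Rightarrow> real) \<Rightarrow> bool" where
  "finite_C1_norm u \<longleftrightarrow>
     C1_plane u \<and> bounded (range u) \<and> (\<forall>i. bounded (range (partial_deriv i u)))"

definition nonlocal_solution :: "(real^2 \<Rightarrow> real) \<Rightarrow> (real^2 \<Rightarrow> real) \<Rightarrow> (real^2 \<Rightarrow> real) \<Rightarrow> bool" where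
  "nonlocal_solution k w h \<longleftrightarrow>
     w \<in> borel_measurable lebesgue \<and>
     (\<forall>x. integrable lebesgue (\<lambda>y. (w x - w y) * k (x - y)) \<and> nonlocal_op k w x = h x)"

definition one_dimensional :: "(real^2 \<Rightarrow> real) \<Rightarrow> bool" where
  "one_dimensional u \<longleftrightarrow> (\<exists>(u\<^sub>0 :: real \<Rightarrow> real) (\<omega> :: real^2). \<forall>x. u x = u\<^sub>0 (\<omega> \<bullet> x))"

end

theory Submission
  imports Defs
begin

text \<open>Let \<open>a = 1 - f' \<circ> u\<close>, so that \<open>k * \<psi> = a \<psi>\<close>, and differentiate the equation of \<open>u\<close>: each
  partial derivative \<open>\<phi>\<close> of \<open>u\<close> satisfies \<open>k * \<phi> = a \<phi>\<close>. Put \<open>\<sigma> = \<phi> / \<psi>\<close> and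
  \<open>W x y = \<psi> x \<psi> y k(x - y)\<close>, a symmetric weight. Testing with \<open>\<tau>\<^sup>2 \<sigma>\<close> and symmetrizing bounds
  \<open>\<integral>\<integral> \<tau>(x)\<^sup>2 (\<sigma> x - \<sigma> y)\<^sup>2 W x y\<close> by \<open>\<integral>\<integral> (\<tau> x - \<tau> y)\<^sup>2 \<sigma>(x)\<^sup>2 W x y\<close>. No Harnack inequality for \<open>\<psi>\<close> is
  needed here, since \<open>\<integral> \<sigma>(x)\<^sup>2 W x y dy = a(x) \<phi>(x)\<^sup>2\<close> is bounded. In the plane, averages of cutoffs
  over \<open>N\<close> separated scales make the right-hand side \<open>O(1/N)\<close>; hence \<open>\<sigma>\<close> is constant, \<open>\<nabla>u = \<psi> \<omega>\<close> for
  a fixed vector \<open>\<omega>\<close>, and \<open>u\<close> is constant on the level sets of \<open>\<omega> \<bullet> x\<close>.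

  The Fubini arguments are carried out for the Borel product measure, so the Lebesgue measurable \<open>k\<close>
  is first replaced by an even Borel kernel; then \<open>\<psi> = (k * \<psi>) / a\<close> is itself Borel.\<close>

section \<open>Reflections, null sets and positivity of convolutions\<close>

lemma lborel_distr_reflect:
  fixes c :: "'a::euclidean_space"
  shows "distr lborel borel (\<lambda>x. c - x) = lborel"
  by (subst lborel_affine[of "-1" c], auto simp: density_1)

lemma
  fixes c :: "'a::euclidean_space" and f :: "'a \<Rightarrow> 'b::{banach, second_countable_topology}"
  assumes [measurable]: "f \<in> borel_measurable borel"
  shows integrable_lborel_reflect: "integrable lborel (\<lambda>x. f (c - x)) \<longleftrightarrow> integrable lborel f"
    and integral_lborel_reflect: "(LINT x|lborel. f (c - x)) = integral\<^sup>L lborel f"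
proof -
  have "integrable (distr lborel borel (\<lambda>x. c - x)) f \<longleftrightarrow> integrable lborel (\<lambda>x. f (c - x))"
    by (subst integrable_distr_eq) auto
  then show "integrable lborel (\<lambda>x. f (c - x)) \<longleftrightarrow> integrable lborel f"
    by (simp add: lborel_distr_reflect)
  have "integral\<^sup>L (distr lborel borel (\<lambda>x. c - x)) f = (LINT x|lborel. f (c - x))"
    by (subst integral_distr) auto
  then show "(LINT x|lborel. f (c - x)) = integral\<^sup>L lborel f"
    by (simp add: lborel_distr_reflect)
qed

lemma AE_lborel_reflect:
  fixes c :: "'a::euclidean_space" and P :: "'a \<Rightarrow> bool"
  assumes "AE x in lborel. P x"
  shows "AE x in lborel. P (c - x)"
proof -
  have "AE x in distr lborel borel (\<lambda>x. c - x). P x"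
    using assms by (subst lborel_distr_reflect)
  then show ?thesis
    by (rule AE_distrD[rotated]) simp
qed

text \<open>Nonempty open sets are not null. Below, this turns almost-everywhere information into
  actual points.\<close>

lemma AE_lborel_open_ex:
  fixes U :: "'a::euclidean_space set"
  assumes "AE x in lborel. P x" "open U" "U \<noteq> {}"
  shows "\<exists>x\<in>U. P x"
proof (rule ccontr)
  assume "\<not> (\<exists>x\<in>U. P x)"
  with assms(1) have "AE x in lborel. x \<notin> U"
    by (auto elim!: eventually_mono)
  then have "U \<in> null_sets lborel"
    using \<open>open U\<close> by (subst AE_iff_null_sets) auto
  then have "negligible U"
    by (simp add: negligible_iff_null_sets null_sets_completionI)
  with assms(2,3) show False
    using open_not_negligible by blast
qed

text \<open>If the integral vanished, the nonnegative integrand would be zero almost everywhere,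
  although it is positive almost everywhere on the ball of radius \<open>r\<close> about
  \<open>x\<close>. This will show that the coefficient \<open>a\<close> has no zero. Asking
  positivity of \<open>p\<close> only almost everywhere lets the lemma apply to a Borel
  representative.\<close>

lemma integral_positive_convolution:
  fixes K p :: "'a::euclidean_space \<Rightarrow> real"
  assumes int: "integrable lborel (\<lambda>y. p y * K (x - y))"
    and p_pos: "AE y in lborel. 0 < p y" and K_nonneg: "\<And>z. 0 \<le> K z"
    and "0 < r" and K_pos: "AE z in lborel. norm z < r \<longrightarrow> 0 < K z"
  shows "0 < (LINT y|lborel. p y * K (x - y))"
proof -
  have nonneg: "AE y in lborel. 0 \<le> p y * K (x - y)"
    using p_pos by eventually_elim (simp add: K_nonneg)
  have "(LINT y|lborel. p y * K (x - y)) \<noteq> 0"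
  proof
    assume "(LINT y|lborel. p y * K (x - y)) = 0"
    then have "AE y in lborel. p y * K (x - y) = 0"
      by (simp only: integral_nonneg_eq_0_iff_AE[OF int nonneg])
    with p_pos AE_lborel_reflect[OF K_pos, of x] have "AE y in lborel. \<not> norm (x - y) < r"
      by eventually_elim auto
    from AE_lborel_open_ex[OF this, of "ball x r"] show False
      using \<open>0 < r\<close> by (auto simp: dist_norm)
  qed
  with integral_nonneg_AE[OF nonneg] show ?thesis
    by simp
qed

section \<open>Cutoffs averaged over separated scales\<close>

lemma sum_square_orthogonal:
  fixes d :: "'i \<Rightarrow> real"
  assumes "finite I" "\<And>i j. i \<in> I \<Longrightarrow> j \<in> I \<Longrightarrow> i \<noteq> j \<Longrightarrow> d i * d j = 0"
  shows "(\<Sum>i\<in>I. d i)\<^sup>2 = (\<Sum>i\<in>I. (d i)\<^sup>2)"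
  using assms
proof (induction I rule: finite_induct)
  case (insert i I)
  have "d i * (\<Sum>j\<in>I. d j) = 0"
    unfolding sum_distrib_left using insert by (intro sum.neutral) auto
  then show ?case
    using insert by (simp add: power2_sum)
qed simp

text \<open>For \<open>\<rho> > 0\<close>: radial, equal to 1 up to radius \<open>\<rho>\<close>,
  equal to 0 from radius \<open>2 * \<rho>\<close> on, and linear in the norm in between.\<close>

definition cutoff :: "real \<Rightarrow> 'a::real_normed_vector \<Rightarrow> real" where
  "cutoff \<rho> x = max 0 (min 1 (2 - norm x / \<rho>))"

lemma cutoff_borel [measurable]: "cutoff \<rho> \<in> borel_measurable borel"
  unfolding cutoff_def by measurable

lemma cutoff_nonneg: "0 \<le> cutoff \<rho> x"
  by (simp add: cutoff_def)

lemma cutoff_le_1: "cutoff \<rho> x \<le> 1"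
  by (simp add: cutoff_def)

lemma cutoff_eq_1: "0 < \<rho> \<Longrightarrow> norm x \<le> \<rho> \<Longrightarrow> cutoff \<rho> x = 1"
  by (auto simp: cutoff_def max_def min_def field_simps)

lemma cutoff_eq_0: "0 < \<rho> \<Longrightarrow> 2 * \<rho> \<le> norm x \<Longrightarrow> cutoff \<rho> x = 0"
  by (auto simp: cutoff_def max_def min_def field_simps)

lemma cutoff_lipschitz:
  assumes "0 < \<rho>"
  shows "\<bar>cutoff \<rho> x - cutoff \<rho> y\<bar> \<le> norm (x - y) / \<rho>"
proof -
  have "\<bar>cutoff \<rho> x - cutoff \<rho> y\<bar> \<le> \<bar>norm x / \<rho> - norm y / \<rho>\<bar>"
    unfolding cutoff_def by linarith
  also have "\<dots> = \<bar>norm x - norm y\<bar> / \<rho>"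
    using assms by (simp flip: diff_divide_distrib)
  also have "\<dots> \<le> norm (x - y) / \<rho>"
    using assms by (intro divide_right_mono norm_triangle_ineq3) simp
  finally show ?thesis .
qed

text \<open>The two points cannot lie on the same plateau of the cutoff, so one of them is beyond
  \<open>\<rho>\<close> and one is inside \<open>2 * \<rho>\<close>; passing from \<open>y\<close>
  to \<open>x\<close> costs less than \<open>R\<close>.\<close>

lemma cutoff_diff_annulus:
  assumes "0 < \<rho>" "norm (x - y) < R" "cutoff \<rho> x \<noteq> cutoff \<rho> y"
  shows "\<rho> - R < norm x" "norm x < 2 * \<rho> + R"
proof -
  have n: "\<bar>norm x - norm y\<bar> < R"
    using norm_triangle_ineq3[of x y] assms(2) by linarith
  have "\<not> (norm x \<le> \<rho> \<and> norm y \<le> \<rho>)" "\<not> (2 * \<rho> \<le> norm x \<and> 2 * \<rho> \<le> norm y)"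
    using assms(1,3) by (auto simp: cutoff_eq_1 cutoff_eq_0)
  with n show "\<rho> - R < norm x" "norm x < 2 * \<rho> + R"
    by linarith+
qed

lemma le_power4_mult: "0 < \<rho> \<Longrightarrow> \<rho> \<le> 4 ^ j * (\<rho>::real)"
  using mult_right_mono[of 1 "4 ^ j" \<rho>] by (simp del: mult_le_cancel_right1 mult_le_cancel_right)

text \<open>The ratio 4 keeps the transition annuli disjoint even when each is widened by
  \<open>R \<le> \<rho>\<close>: at scale \<open>s = 4 ^ j * \<rho>\<close> the widened annulus ends
  at \<open>2 * s + R \<le> 3 * s\<close>, while the next one begins at
  \<open>4 * s - R \<ge> 3 * s\<close>.\<close>

definition avg_cutoff :: "real \<Rightarrow> nat \<Rightarrow> 'a::real_normed_vector \<Rightarrow> real" where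
  "avg_cutoff \<rho> N x = (\<Sum>j<N. cutoff (4 ^ j * \<rho>) x) / N"

text \<open>Majorant for the squared increments of \<open>avg_cutoff\<close> over distances below
  \<open>R\<close>. It depends on \<open>x\<close> alone, so \<open>y\<close> can be integrated out
  against the weight \<open>W\<close>. The ball of radius \<open>3 * s\<close> contains the annulus
  of scale \<open>s\<close> widened by \<open>R\<close>.\<close>

definition avg_grad_bound :: "real \<Rightarrow> real \<Rightarrow> nat \<Rightarrow> 'a::real_normed_vector \<Rightarrow> real" where
  "avg_grad_bound R \<rho> N x =
     (\<Sum>j<N. (R / (4 ^ j * \<rho>))\<^sup>2 * indicator (ball 0 (3 * (4 ^ j * \<rho>))) x) / (real N)\<^sup>2"

lemma avg_cutoff_borel [measurable]: "avg_cutoff \<rho> N \<in> borel_measurable borel"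
  unfolding avg_cutoff_def by measurable

lemma avg_cutoff_eq_1:
  assumes "0 < \<rho>" "0 < N" "norm x \<le> \<rho>"
  shows "avg_cutoff \<rho> N x = 1"
proof -
  have "cutoff (4 ^ j * \<rho>) x = 1" for j :: nat
  proof (rule cutoff_eq_1)
    show "norm x \<le> 4 ^ j * \<rho>"
      using assms le_power4_mult[of \<rho> j] by linarith
  qed (use assms in simp)
  then show ?thesis
    using assms by (simp add: avg_cutoff_def)
qed

text \<open>The annuli where two different scales vary are further apart than \<open>R\<close>.\<close>
lemma cutoff_diff_orthogonal:
  assumes "R \<le> \<rho>" "0 < \<rho>" "norm (x - y) < R" "i \<noteq> j"
  shows "(cutoff (4 ^ i * \<rho>) x - cutoff (4 ^ i * \<rho>) y) * (cutoff (4 ^ j * \<rho>) x - cutoff (4 ^ j * \<rho>) y) = 0"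
  using \<open>i \<noteq> j\<close>
proof (induction i j rule: linorder_wlog)
  case (le i j)
  have "4 ^ Suc i \<le> (4::real) ^ j"
    using le by (intro power_increasing) auto
  then have 1: "4 * (4 ^ i * \<rho>) \<le> 4 ^ j * \<rho>"
    using \<open>0 < \<rho>\<close> by simp
  have 2: "R \<le> 4 ^ i * \<rho>"
    using assms le_power4_mult[of \<rho> i] by linarith
  show ?case
  proof (rule ccontr)
    assume "\<not> ?thesis"
    then have "cutoff (4 ^ i * \<rho>) x \<noteq> cutoff (4 ^ i * \<rho>) y" "cutoff (4 ^ j * \<rho>) x \<noteq> cutoff (4 ^ j * \<rho>) y"
      by auto
    then have "norm x < 2 * (4 ^ i * \<rho>) + R" "4 ^ j * \<rho> - R < norm x"
      using assms by (auto intro!: cutoff_diff_annulus)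
    with 1 2 show False
      by linarith
  qed
qed (simp add: mult.commute)

text \<open>Increments at different scales have product zero, so squaring the sum produces no mixed
  terms: \<open>N\<close> terms face the denominator \<open>N\<^sup>2\<close>. Each of them is
  bounded by the Lipschitz estimate and localized by the annulus.\<close>

lemma avg_cutoff_diff_le:
  assumes "R \<le> \<rho>" "0 < \<rho>" "norm (x - y) < R"
  shows "(avg_cutoff \<rho> N x - avg_cutoff \<rho> N y)\<^sup>2 \<le> avg_grad_bound R \<rho> N x"
proof -
  define d where "d j = cutoff (4 ^ j * \<rho>) x - cutoff (4 ^ j * \<rho>) y" for j :: nat
  have "avg_cutoff \<rho> N x - avg_cutoff \<rho> N y = (\<Sum>j<N. d j) / N"
    by (simp add: avg_cutoff_def d_def sum_subtractf diff_divide_distrib)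
  then have "(avg_cutoff \<rho> N x - avg_cutoff \<rho> N y)\<^sup>2 = (\<Sum>j<N. d j)\<^sup>2 / (real N)\<^sup>2"
    by (simp add: power_divide)
  also have "(\<Sum>j<N. d j)\<^sup>2 = (\<Sum>j<N. (d j)\<^sup>2)"
    unfolding d_def by (intro sum_square_orthogonal cutoff_diff_orthogonal[OF assms]) auto
  also have "\<dots> / (real N)\<^sup>2 \<le> avg_grad_bound R \<rho> N x"
    unfolding avg_grad_bound_def
  proof (intro divide_right_mono sum_mono)
    fix j
    have pos: "0 < 4 ^ j * \<rho>" and le: "R \<le> 4 ^ j * \<rho>"
      using assms le_power4_mult[of \<rho> j] by (simp, linarith)
    show "(d j)\<^sup>2 \<le> (R / (4 ^ j * \<rho>))\<^sup>2 * indicator (ball 0 (3 * (4 ^ j * \<rho>))) x"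
    proof (cases "d j = 0")
      case False
      then have "norm x < 2 * (4 ^ j * \<rho>) + R"
        using cutoff_diff_annulus(2)[OF pos assms(3)] by (auto simp: d_def)
      then have "x \<in> ball 0 (3 * (4 ^ j * \<rho>))"
        using le by simp
      moreover have "\<bar>d j\<bar> \<le> R / (4 ^ j * \<rho>)"
        using cutoff_lipschitz[OF pos, of x y] divide_right_mono[of "norm (x - y)" R "4 ^ j * \<rho>"] assms(3) pos
        unfolding d_def by linarith
      ultimately show ?thesis
        using power_mono[of "\<bar>d j\<bar>" _ 2] by simp
    qed simp
  qed simp
  finally show ?thesis .
qed

lemma avg_grad_bound_nonneg: "0 \<le> avg_grad_bound R \<rho> N x"
  unfolding avg_grad_bound_def by (intro divide_nonneg_nonneg sum_nonneg) auto

lemma integrable_indicator_ball: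
  "integrable lborel (indicator (ball (c::'a::euclidean_space) r) :: 'a \<Rightarrow> real)"
  by (rule integrable_real_indicator) (simp_all add: emeasure_bounded_finite[unfolded infinity_ennreal_def])

lemma avg_grad_bound_integrable:
  "integrable lborel (avg_grad_bound R \<rho> N :: 'a::euclidean_space \<Rightarrow> real)"
  unfolding avg_grad_bound_def
  by (intro integrable_divide_zero Bochner_Integration.integrable_sum integrable_mult_right
      integrable_indicator_ball impI)

text \<open>In dimension two each scale contributes the same amount, so averaging over \<open>N\<close> scales gains
  a factor \<open>1/N\<close>.\<close>
lemma avg_grad_bound_integral:
  assumes "0 < \<rho>" "DIM('a::euclidean_space) = 2"
  shows "integral\<^sup>L lborel (avg_grad_bound R \<rho> N :: 'a \<Rightarrow> real) = 9 * pi * R\<^sup>2 / N"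
proof -
  have "integral\<^sup>L lborel (avg_grad_bound R \<rho> N :: 'a \<Rightarrow> real) =
      (\<Sum>j<N. (R / (4 ^ j * \<rho>))\<^sup>2 * measure lborel (ball (0::'a) (3 * (4 ^ j * \<rho>)))) / (real N)\<^sup>2"
    unfolding avg_grad_bound_def
    by (subst integral_divide_zero, subst Bochner_Integration.integral_sum)
      (simp_all add: integrable_indicator_ball del: sum_mult_indicator)
  also have "\<dots> = (\<Sum>j<N. 9 * pi * R\<^sup>2) / (real N)\<^sup>2"
    using assms by (simp add: content_ball unit_ball_vol_2 power_mult_distrib power_divide)
  also have "\<dots> = 9 * pi * R\<^sup>2 / N"
    by (simp add: power2_eq_square)
  finally show ?thesis .
qed

lemma avg_cutoff_square_integrable:
  assumes "0 < \<rho>"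
  shows "integrable lborel (\<lambda>x::'a::euclidean_space. (avg_cutoff \<rho> N x)\<^sup>2)"
proof (rule Bochner_Integration.integrable_bound)
  show "integrable lborel (indicator (ball (0::'a) (2 * (4 ^ N * \<rho>))) :: 'a \<Rightarrow> real)"
    by (rule integrable_indicator_ball)
  have le: "(avg_cutoff \<rho> N x)\<^sup>2 \<le> indicator (ball 0 (2 * (4 ^ N * \<rho>))) x" for x :: 'a
  proof (cases "norm x < 2 * (4 ^ N * \<rho>)")
    case True
    have "(\<Sum>j<N. cutoff (4 ^ j * \<rho>) x) \<le> (\<Sum>j<N. 1)"
      by (intro sum_mono cutoff_le_1)
    then have "avg_cutoff \<rho> N x \<le> 1"
      by (cases "N = 0") (auto simp: avg_cutoff_def divide_le_eq_1)
    moreover have "0 \<le> avg_cutoff \<rho> N x"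
      by (simp add: avg_cutoff_def sum_nonneg cutoff_nonneg)
    ultimately show ?thesis
      using True by (simp add: power_le_one)
  next
    case False
    have "cutoff (4 ^ j * \<rho>) x = 0" if "j < N" for j
    proof (rule cutoff_eq_0)
      have "(4::real) ^ j \<le> 4 ^ N"
        using that by (intro power_increasing) auto
      then have "4 ^ j * \<rho> \<le> 4 ^ N * \<rho>"
        using assms by simp
      then show "2 * (4 ^ j * \<rho>) \<le> norm x"
        using False by linarith
    qed (use assms in simp)
    then show ?thesis
      by (simp add: avg_cutoff_def)
  qed
  show "AE x in lborel. norm ((avg_cutoff \<rho> N x)\<^sup>2) \<le> norm (indicator (ball (0::'a) (2 * (4 ^ N * \<rho>))) x :: real)"
  proof (intro AE_I2)
    fix x :: 'a
    show "norm ((avg_cutoff \<rho> N x)\<^sup>2) \<le> norm (indicator (ball 0 (2 * (4 ^ N * \<rho>))) x :: real)"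
      using le[of x] zero_le_power2[of "avg_cutoff \<rho> N x"] unfolding real_norm_def by linarith
  qed
qed measurable

section \<open>Energy estimate for the linearized equation\<close>

text \<open>Split \<open>s\<^sup>2 * p - t\<^sup>2 * q\<close> into \<open>(s\<^sup>2 + t\<^sup>2) *
  (p - q) / 2 + (s\<^sup>2 - t\<^sup>2) * (p + q) / 2\<close> and apply Young's inequality to the
  second part. In the proof, the first square is the one behind Young's inequality; the other two
  terms are the surplus from the parallelogram identities for \<open>s, t\<close> and for
  \<open>p, q\<close>.\<close>

lemma energy_pointwise:
  fixes s t p q :: real
  shows "(s\<^sup>2 + t\<^sup>2) * (p - q)\<^sup>2 / 4 - (s - t)\<^sup>2 * (p\<^sup>2 + q\<^sup>2) \<le> (s\<^sup>2 * p - t\<^sup>2 * q) * (p - q)"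
proof -
  have "0 \<le> ((s + t) * (p - q) / 2 + (s - t) * (p + q))\<^sup>2 / 2
      + (s - t)\<^sup>2 * (p - q)\<^sup>2 / 8 + (s - t)\<^sup>2 * (p - q)\<^sup>2 / 2"
    by simp
  also have "\<dots> = (s\<^sup>2 * p - t\<^sup>2 * q) * (p - q) - ((s\<^sup>2 + t\<^sup>2) * (p - q)\<^sup>2 / 4 - (s - t)\<^sup>2 * (p\<^sup>2 + q\<^sup>2))"
    by (simp add: field_simps power2_eq_square)
  finally show ?thesis
    by simp
qed

text \<open>For a kernel of mass 1, an equation \<open>L w = c w\<close> with the nonlocal operator
  \<open>L\<close> reads \<open>K * w = (1 - c) w\<close> in convolution form; \<open>a\<close>
  stands for \<open>1 - c\<close>. Here \<open>\<phi>\<close> is a bounded solution of any sign,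
  \<open>\<psi>\<close> a positive one without a bound.\<close>

locale linearized_equation =
  fixes K \<phi> \<psi> a :: "'a::euclidean_space \<Rightarrow> real" and R A B :: real
  assumes R_pos: "0 < R"
    and K_borel [measurable]: "K \<in> borel_measurable borel"
    and K_even: "K (- z) = K z"
    and K_nonneg: "0 \<le> K z"
    and K_support: "R \<le> norm z \<Longrightarrow> K z = 0"
    and K_integrable: "integrable lborel K"
    and phi_borel [measurable]: "\<phi> \<in> borel_measurable borel"
    and phi_bound: "\<bar>\<phi> x\<bar> \<le> B"
    and psi_borel [measurable]: "\<psi> \<in> borel_measurable borel"
    and psi_pos: "0 < \<psi> x"
    and a_borel [measurable]: "a \<in> borel_measurable borel"
    and a_le: "a x \<le> A"
    and psi_integrable: "integrable lborel (\<lambda>y. \<psi> y * K (x - y))"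
    and psi_eq: "(LINT y|lborel. \<psi> y * K (x - y)) = a x * \<psi> x"
    and phi_eq: "(LINT y|lborel. \<phi> y * K (x - y)) = a x * \<phi> x"
begin

definition \<sigma> :: "'a \<Rightarrow> real" where "\<sigma> x = \<phi> x / \<psi> x"

definition W :: "'a \<Rightarrow> 'a \<Rightarrow> real" where "W x y = \<psi> x * \<psi> y * K (x - y)"

lemma sigma_borel [measurable]: "\<sigma> \<in> borel_measurable borel"
  unfolding \<sigma>_def by measurable

lemma W_borel [measurable]: "case_prod W \<in> borel_measurable (lborel \<Otimes>\<^sub>M lborel)"
  unfolding W_def by measurable

lemma sigma_psi: "\<sigma> x * \<psi> x = \<phi> x"
  using psi_pos[of x] by (simp add: \<sigma>_def)

lemma K_sym: "K (x - y) = K (y - x)"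
  using K_even[of "x - y"] by simp

lemma W_sym: "W x y = W y x"
  by (simp add: W_def K_sym[of x y] mult.commute)

lemma W_nonneg: "0 \<le> W x y"
  using psi_pos[of x] psi_pos[of y] K_nonneg[of "x - y"] by (simp add: W_def)

lemma a_nonneg: "0 \<le> a x"
proof -
  have "0 \<le> (LINT y|lborel. \<psi> y * K (x - y))"
    by (intro integral_nonneg_AE AE_I2 mult_nonneg_nonneg K_nonneg less_imp_le[OF psi_pos])
  then show ?thesis
    using psi_pos[of x] by (simp add: psi_eq zero_le_mult_iff)
qed

lemma W_integrable: "integrable lborel (W x)"
  unfolding W_def using psi_integrable[of x] by (simp add: mult.assoc)

lemma W_integral: "integral\<^sup>L lborel (W x) = a x * (\<psi> x)\<^sup>2"
proof -
  have "integral\<^sup>L lborel (W x) = (LINT y|lborel. \<psi> x * (\<psi> y * K (x - y)))"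
    unfolding W_def by (simp add: mult.assoc)
  then show ?thesis
    by (simp add: psi_eq power2_eq_square)
qed

lemma A_nonneg: "0 \<le> A"
  using a_nonneg[of undefined] a_le[of undefined] by linarith

lemma B_nonneg: "0 \<le> B"
  using phi_bound[of undefined] by linarith

lemma sq_weight_integral: "\<sigma> x ^ 2 * (a x * (\<psi> x)\<^sup>2) = a x * (\<phi> x)\<^sup>2"
  by (simp add: sigma_psi[symmetric] power_mult_distrib)

lemma sq_weight_le: "a x * (\<phi> x)\<^sup>2 \<le> A * B\<^sup>2"
  using a_nonneg[of x] a_le[of x] phi_bound[of x]
  by (intro mult_mono abs_le_square_iff[THEN iffD1]) auto

text \<open>The quotient \<open>\<sigma>\<close> may be unbounded. Integrating over \<open>y\<close>
  first replaces \<open>\<sigma>\<close> and \<open>W\<close> by \<open>a * \<phi>\<^sup>2\<close>,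
  which is at most \<open>A * B\<^sup>2\<close>; nonnegativity allows the order of integration to be
  chosen.\<close>

lemma
  fixes h :: "'a \<Rightarrow> real"
  assumes h: "integrable lborel h" "\<And>x. 0 \<le> h x"
  shows sigma_sq_integrable: "integrable (lborel \<Otimes>\<^sub>M lborel) (\<lambda>(x, y). h x * (\<sigma> x)\<^sup>2 * W x y)"
    and sigma_sq_integral_le:
      "(LINT p|(lborel \<Otimes>\<^sub>M lborel). (case p of (x, y) \<Rightarrow> h x * (\<sigma> x)\<^sup>2 * W x y))
        \<le> A * B\<^sup>2 * integral\<^sup>L lborel h"
proof -
  have hb [measurable]: "h \<in> borel_measurable borel"
    using borel_measurable_integrable[OF h(1)] by simp
  have inner: "(LINT y|lborel. h x * (\<sigma> x)\<^sup>2 * W x y) = h x * (a x * (\<phi> x)\<^sup>2)" for x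
    by (simp add: W_integral sq_weight_integral)
  have outer: "integrable lborel (\<lambda>x. h x * (a x * (\<phi> x)\<^sup>2))"
  proof (rule Bochner_Integration.integrable_bound[of _ "\<lambda>x. A * B\<^sup>2 * h x"])
    show "AE x in lborel. norm (h x * (a x * (\<phi> x)\<^sup>2)) \<le> norm (A * B\<^sup>2 * h x)"
    proof (intro AE_I2)
      fix x
      have "h x * (a x * (\<phi> x)\<^sup>2) \<le> h x * (A * B\<^sup>2)"
        by (intro mult_left_mono sq_weight_le h)
      then show "norm (h x * (a x * (\<phi> x)\<^sup>2)) \<le> norm (A * B\<^sup>2 * h x)"
        using h(2)[of x] a_nonneg[of x] A_nonneg by (simp add: abs_mult mult_ac)
    qed
  qed (use h in auto)
  show int: "integrable (lborel \<Otimes>\<^sub>M lborel) (\<lambda>(x, y). h x * (\<sigma> x)\<^sup>2 * W x y)"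
  proof (rule lborel_pair.Fubini_integrable)
    have "norm (h x * (\<sigma> x)\<^sup>2 * W x y) = h x * (\<sigma> x)\<^sup>2 * W x y" for x y
      using h(2)[of x] W_nonneg[of x y] by simp
    then show "integrable lborel (\<lambda>x. LINT y|lborel. norm (case (x, y) of (x, y) \<Rightarrow> h x * (\<sigma> x)\<^sup>2 * W x y))"
      using outer by (simp only: prod.case inner)
  qed (use W_integrable in auto)
  have "(LINT p|(lborel \<Otimes>\<^sub>M lborel). (case p of (x, y) \<Rightarrow> h x * (\<sigma> x)\<^sup>2 * W x y))
      = (LINT x|lborel. LINT y|lborel. h x * (\<sigma> x)\<^sup>2 * W x y)"
    using lborel_pair.integral_fst'[OF int] by simp
  also have "\<dots> = (LINT x|lborel. h x * (a x * (\<phi> x)\<^sup>2))"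
    by (simp only: inner)
  also have "\<dots> \<le> (LINT x|lborel. A * B\<^sup>2 * h x)"
  proof (rule integral_mono[OF outer])
    show "h x * (a x * (\<phi> x)\<^sup>2) \<le> A * B\<^sup>2 * h x" for x
      using mult_left_mono[OF sq_weight_le h(2), of x] by (simp add: mult.commute)
  qed (use h in simp)
  finally show "(LINT p|(lborel \<Otimes>\<^sub>M lborel). (case p of (x, y) \<Rightarrow> h x * (\<sigma> x)\<^sup>2 * W x y))
        \<le> A * B\<^sup>2 * integral\<^sup>L lborel h"
    by simp
qed

lemma cross_eq: "\<sigma> x * \<sigma> y * W x y = \<phi> x * (\<phi> y * K (x - y))"
  by (simp add: W_def sigma_psi[symmetric])

text \<open>The mixed term carries no trace of \<open>\<psi>\<close>: it equals
  \<open>h x * \<phi> x * \<phi> y * K (x - y)\<close> and is dominated by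
  \<open>B\<^sup>2 * h x * K (x - y)\<close>.\<close>

lemma cross_integrable:
  fixes h :: "'a \<Rightarrow> real"
  assumes h: "integrable lborel h" "\<And>x. 0 \<le> h x"
  shows "integrable (lborel \<Otimes>\<^sub>M lborel) (\<lambda>(x, y). h x * (\<sigma> x * \<sigma> y) * W x y)"
proof (rule Bochner_Integration.integrable_bound)
  have hb [measurable]: "h \<in> borel_measurable borel"
    using borel_measurable_integrable[OF h(1)] by simp
  show "integrable (lborel \<Otimes>\<^sub>M lborel) (\<lambda>(x, y). B\<^sup>2 * (h x * K (x - y)))"
  proof (rule lborel_pair.Fubini_integrable)
    have "(LINT y|lborel. norm (B\<^sup>2 * (h x * K (x - y)))) = (B\<^sup>2 * integral\<^sup>L lborel K) * h x" for x
      using h(2)[of x] K_nonneg by (simp add: abs_mult integral_lborel_reflect)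
    then show "integrable lborel (\<lambda>x. LINT y|lborel. norm (case (x, y) of (x, y) \<Rightarrow> B\<^sup>2 * (h x * K (x - y))))"
      using h by simp
    show "AE x in lborel. integrable lborel (\<lambda>y. case (x, y) of (x, y) \<Rightarrow> B\<^sup>2 * (h x * K (x - y)))"
      using K_integrable by (simp add: integrable_lborel_reflect)
  qed measurable
  show "(\<lambda>(x, y). h x * (\<sigma> x * \<sigma> y) * W x y) \<in> borel_measurable (lborel \<Otimes>\<^sub>M lborel)"
    by measurable
  have "norm (h x * (\<sigma> x * \<sigma> y) * W x y) \<le> norm (B\<^sup>2 * (h x * K (x - y)))" for x y
  proof -
    have "\<bar>\<phi> x\<bar> * \<bar>\<phi> y\<bar> \<le> B * B"
      by (intro mult_mono phi_bound B_nonneg abs_ge_zero)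
    then have "(h x * K (x - y)) * (\<bar>\<phi> x\<bar> * \<bar>\<phi> y\<bar>) \<le> (h x * K (x - y)) * (B * B)"
      using h(2)[of x] K_nonneg[of "x - y"] by (intro mult_left_mono) auto
    then show ?thesis
      using h(2)[of x] K_nonneg[of "x - y"] cross_eq[of x y]
      by (simp add: abs_mult mult_ac power2_eq_square)
  qed
  then show "AE p in (lborel \<Otimes>\<^sub>M lborel). norm (case p of (x, y) \<Rightarrow> h x * (\<sigma> x * \<sigma> y) * W x y)
      \<le> norm (case p of (x, y) \<Rightarrow> B\<^sup>2 * (h x * K (x - y)))"
    by (auto simp: split_beta')
qed

text \<open>Weak form of the equation for \<open>\<sigma>\<close>. For fixed \<open>x\<close> the
  inner integral is \<open>h x * \<sigma> x\<close> times \<open>\<sigma> x * (a x * (\<psi>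
  x)\<^sup>2) - \<psi> x * (a x * \<phi> x)\<close>, which is zero since
  \<open>\<sigma> x * \<psi> x = \<phi> x\<close>. Square and mixed parts are integrable separately,
  which justifies the splitting and Fubini.\<close>

lemma tested_equation:
  fixes h :: "'a \<Rightarrow> real"
  assumes h: "integrable lborel h" "\<And>x. 0 \<le> h x"
  shows tested_integrable:
      "integrable (lborel \<Otimes>\<^sub>M lborel) (\<lambda>(x, y). h x * \<sigma> x * (\<sigma> x - \<sigma> y) * W x y)"
    and tested_integral:
      "(LINT p|(lborel \<Otimes>\<^sub>M lborel). (case p of (x, y) \<Rightarrow> h x * \<sigma> x * (\<sigma> x - \<sigma> y) * W x y)) = 0"
proof -
  have eq: "h x * \<sigma> x * (\<sigma> x - \<sigma> y) * W x y
      = h x * (\<sigma> x)\<^sup>2 * W x y - h x * (\<sigma> x * \<sigma> y) * W x y" for x y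
    by (simp add: algebra_simps power2_eq_square)
  show int: "integrable (lborel \<Otimes>\<^sub>M lborel) (\<lambda>(x, y). h x * \<sigma> x * (\<sigma> x - \<sigma> y) * W x y)"
    using Bochner_Integration.integrable_diff[OF sigma_sq_integrable[OF h] cross_integrable[OF h]]
    by (simp add: eq split_beta')
  have "(LINT y|lborel. h x * \<sigma> x * (\<sigma> x - \<sigma> y) * W x y) = 0" for x
  proof -
    have eq': "h x * \<sigma> x * (\<sigma> x - \<sigma> y) * W x y
        = h x * (\<sigma> x)\<^sup>2 * W x y - h x * \<phi> x * (\<phi> y * K (x - y))" for y
      using cross_eq[of x y] unfolding eq by (simp add: mult.assoc)
    have i: "integrable lborel (\<lambda>y. \<phi> y * K (x - y))"
    proof (rule Bochner_Integration.integrable_bound)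
      show "integrable lborel (\<lambda>y. B * K (x - y))"
        using K_integrable by (simp add: integrable_lborel_reflect)
      show "AE y in lborel. norm (\<phi> y * K (x - y)) \<le> norm (B * K (x - y))"
        using phi_bound B_nonneg K_nonneg by (auto simp: abs_mult intro!: mult_right_mono)
    qed measurable
    have "(LINT y|lborel. h x * \<sigma> x * (\<sigma> x - \<sigma> y) * W x y)
        = h x * (\<sigma> x)\<^sup>2 * (a x * (\<psi> x)\<^sup>2) - h x * \<phi> x * (a x * \<phi> x)"
      unfolding eq' using i W_integrable[of x]
      by (subst Bochner_Integration.integral_diff) (simp_all add: W_integral phi_eq)
    also have "\<dots> = 0"
      by (simp add: sigma_psi[symmetric] power2_eq_square)
    finally show ?thesis .
  qed
  then show "(LINT p|(lborel \<Otimes>\<^sub>M lborel). (case p of (x, y) \<Rightarrow> h x * \<sigma> x * (\<sigma> x - \<sigma> y) * W x y)) = 0"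
    using lborel_pair.integral_fst'[OF int] by simp
qed

lemma energy_estimate:
  fixes \<tau> h :: "'a \<Rightarrow> real"
  assumes [measurable]: "\<tau> \<in> borel_measurable borel"
    and tau: "integrable lborel (\<lambda>x. (\<tau> x)\<^sup>2)"
    and h: "integrable lborel h" "\<And>x. 0 \<le> h x"
    and grad: "\<And>x y. norm (x - y) < R \<Longrightarrow> (\<tau> x - \<tau> y)\<^sup>2 \<le> h x"
  shows energy_integrable:
      "integrable (lborel \<Otimes>\<^sub>M lborel) (\<lambda>(x, y). (\<tau> x)\<^sup>2 * (\<sigma> x - \<sigma> y)\<^sup>2 * W x y)"
    and energy_le:
      "(LINT p|(lborel \<Otimes>\<^sub>M lborel). (case p of (x, y) \<Rightarrow> (\<tau> x)\<^sup>2 * (\<sigma> x - \<sigma> y)\<^sup>2 * W x y))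
        \<le> 8 * (A * B\<^sup>2) * integral\<^sup>L lborel h"
proof -
  let ?M = "lborel \<Otimes>\<^sub>M (lborel :: 'a measure)"
  define S where "S = (\<lambda>(x, y). (\<tau> x)\<^sup>2 * \<sigma> x * (\<sigma> x - \<sigma> y) * W x y)"
  define H where "H = (\<lambda>(x, y). h x * (\<sigma> x)\<^sup>2 * W x y)"
  have S: "integrable ?M S" "integral\<^sup>L ?M S = 0"
    unfolding S_def using tested_integrable[OF tau] tested_integral[OF tau] by auto
  have H: "integrable ?M H" "integral\<^sup>L ?M H \<le> A * B\<^sup>2 * integral\<^sup>L lborel h"
    unfolding H_def using sigma_sq_integrable[OF h] sigma_sq_integral_le[OF h] by auto
  have S': "integrable ?M (\<lambda>(x, y). S (y, x))" "integral\<^sup>L ?M (\<lambda>(x, y). S (y, x)) = 0"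
    using lborel_pair.integrable_product_swap[OF S(1)] lborel_pair.integral_product_swap[of S] S by auto
  have H': "integrable ?M (\<lambda>(x, y). H (y, x))" "integral\<^sup>L ?M (\<lambda>(x, y). H (y, x)) = integral\<^sup>L ?M H"
    using lborel_pair.integrable_product_swap[OF H(1)] lborel_pair.integral_product_swap[of H] H by auto
  \<comment> \<open>Adding the coordinate swap to \<open>S\<close> symmetrizes the tested equation
    without changing its zero integral. The 4 clears the denominator in
    \<open>energy_pointwise\<close>; \<open>H\<close> and its swap contribute equally, which gives
    the constant 8.\<close>
  define D where "D = (\<lambda>p. 4 * ((S p + (case p of (x, y) \<Rightarrow> S (y, x))) + (H p + (case p of (x, y) \<Rightarrow> H (y, x)))))"
  have D: "integrable ?M D"
    unfolding D_def using S S' H H' by (intro integrable_mult_right Bochner_Integration.integrable_add impI)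
  have "integral\<^sup>L ?M D = 8 * integral\<^sup>L ?M H"
    unfolding D_def using S S' H H' by simp
  with H(2) have D_le: "integral\<^sup>L ?M D \<le> 8 * (A * B\<^sup>2) * integral\<^sup>L lborel h"
    by simp
  have pointwise: "(\<tau> x)\<^sup>2 * (\<sigma> x - \<sigma> y)\<^sup>2 * W x y \<le> D (x, y)" for x y
  proof (cases "norm (x - y) < R")
    case True
    then have g: "(\<tau> x - \<tau> y)\<^sup>2 \<le> h x" "(\<tau> x - \<tau> y)\<^sup>2 \<le> h y"
      using grad[of x y] grad[of y x] by (simp_all add: norm_minus_commute power2_commute)
    have "(\<tau> x)\<^sup>2 * (\<sigma> x - \<sigma> y)\<^sup>2 \<le> ((\<tau> x)\<^sup>2 + (\<tau> y)\<^sup>2) * (\<sigma> x - \<sigma> y)\<^sup>2"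
      by (intro mult_right_mono) auto
    also have "\<dots> \<le> 4 * (((\<tau> x)\<^sup>2 * \<sigma> x - (\<tau> y)\<^sup>2 * \<sigma> y) * (\<sigma> x - \<sigma> y)
        + ((\<tau> x - \<tau> y)\<^sup>2 * (\<sigma> x)\<^sup>2 + (\<tau> x - \<tau> y)\<^sup>2 * (\<sigma> y)\<^sup>2))"
      using energy_pointwise[of "\<tau> x" "\<tau> y" "\<sigma> x" "\<sigma> y"] by (simp add: distrib_left)
    also have "\<dots> \<le> 4 * (((\<tau> x)\<^sup>2 * \<sigma> x - (\<tau> y)\<^sup>2 * \<sigma> y) * (\<sigma> x - \<sigma> y)
        + (h x * (\<sigma> x)\<^sup>2 + h y * (\<sigma> y)\<^sup>2))"
      using g by (intro mult_left_mono add_left_mono add_mono mult_right_mono) auto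
    finally have "(\<tau> x)\<^sup>2 * (\<sigma> x - \<sigma> y)\<^sup>2 * W x y \<le> \<dots> * W x y"
      by (rule mult_right_mono[OF _ W_nonneg])
    also have "\<dots> = D (x, y)"
      by (simp add: D_def S_def H_def W_sym[of y x] algebra_simps)
    finally show ?thesis .
  next
    \<comment> \<open>Outside the range of the kernel both sides vanish, so the increment bound on
      \<open>\<tau>\<close> is only called for at distances below \<open>R\<close>.\<close>
    case False
    then have "W x y = 0" "W y x = 0"
      using K_support[of "x - y"] W_sym[of y x] by (simp_all add: W_def)
    then show ?thesis
      by (simp add: D_def S_def H_def)
  qed
  have nonneg: "0 \<le> (\<tau> x)\<^sup>2 * (\<sigma> x - \<sigma> y)\<^sup>2 * W x y" for x y
    using W_nonneg by simp
  show int: "integrable ?M (\<lambda>(x, y). (\<tau> x)\<^sup>2 * (\<sigma> x - \<sigma> y)\<^sup>2 * W x y)"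
  proof (rule Bochner_Integration.integrable_bound[OF D])
    have "norm ((\<tau> x)\<^sup>2 * (\<sigma> x - \<sigma> y)\<^sup>2 * W x y) \<le> norm (D (x, y))" for x y
      using pointwise[of x y] nonneg[of x y] unfolding real_norm_def by linarith
    then show "AE p in ?M. norm (case p of (x, y) \<Rightarrow> (\<tau> x)\<^sup>2 * (\<sigma> x - \<sigma> y)\<^sup>2 * W x y) \<le> norm (D p)"
      by (auto simp only: split_paired_All prod.case intro!: AE_I2)
  qed measurable
  have "(LINT p|?M. (case p of (x, y) \<Rightarrow> (\<tau> x)\<^sup>2 * (\<sigma> x - \<sigma> y)\<^sup>2 * W x y)) \<le> integral\<^sup>L ?M D"
    using pointwise by (intro integral_mono[OF int D]) auto
  with D_le show "(LINT p|?M. (case p of (x, y) \<Rightarrow> (\<tau> x)\<^sup>2 * (\<sigma> x - \<sigma> y)\<^sup>2 * W x y))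
        \<le> 8 * (A * B\<^sup>2) * integral\<^sup>L lborel h"
    by linarith
qed

section \<open>From zero energy to a constant quotient\<close>

text \<open>The energy over the ball does not depend on \<open>N\<close>, yet for every positive
  \<open>N\<close> it is at most the energy weighted by the squared averaged cutoff, which is
  bounded by a constant over \<open>N\<close>.\<close>

lemma energy_vanishes_on_ball:
  assumes dim: "DIM('a) = 2" and "R \<le> \<rho>"
  shows "AE p in lborel \<Otimes>\<^sub>M lborel.
    (case p of (x, y) \<Rightarrow> indicator (ball 0 \<rho>) x * ((\<sigma> x - \<sigma> y)\<^sup>2 * W x y)) = 0"
proof -
  let ?M = "lborel \<Otimes>\<^sub>M (lborel :: 'a measure)"
  let ?g = "\<lambda>p::'a \<times> 'a. case p of (x, y) \<Rightarrow> indicator (ball 0 \<rho>) x * ((\<sigma> x - \<sigma> y)\<^sup>2 * W x y)"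
  have [measurable]: "ball (0::'a) \<rho> \<in> sets borel"
    by simp
  have \<rho>: "0 < \<rho>"
    using R_pos assms by simp
  define E where "E N = (\<lambda>(x, y). (avg_cutoff \<rho> N x)\<^sup>2 * (\<sigma> x - \<sigma> y)\<^sup>2 * W x y)" for N
  have E: "integrable ?M (E N)" "integral\<^sup>L ?M (E N) \<le> (8 * (A * B\<^sup>2) * (9 * pi * R\<^sup>2)) / N" for N
  proof -
    note est = avg_cutoff_borel avg_cutoff_square_integrable[OF \<rho>] avg_grad_bound_integrable
      avg_grad_bound_nonneg avg_cutoff_diff_le[OF \<open>R \<le> \<rho>\<close> \<rho>]
    show "integrable ?M (E N)"
      unfolding E_def by (rule energy_integrable[OF est])
    show "integral\<^sup>L ?M (E N) \<le> (8 * (A * B\<^sup>2) * (9 * pi * R\<^sup>2)) / N"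
      using energy_le[OF est, of N] unfolding E_def avg_grad_bound_integral[OF \<rho> dim] by simp
  qed
  have nonneg: "0 \<le> ?g p" for p
    using W_nonneg by (auto split: prod.split simp: indicator_def)
  \<comment> \<open>Positivity of \<open>N\<close> matters: for \<open>N = 0\<close> the average is
    \<open>0 / 0 = 0\<close> rather than 1 on the ball.\<close>
  have le: "?g p \<le> E N p" if "0 < N" for N p
  proof (cases p)
    case (Pair x y)
    show ?thesis
    proof (cases "x \<in> ball 0 \<rho>")
      case True
      then show ?thesis
        using avg_cutoff_eq_1[OF \<rho> that, of x] by (simp add: Pair E_def)
    next
      case False
      then show ?thesis
        using W_nonneg by (simp add: Pair E_def)
    qed
  qed
  have int: "integrable ?M ?g"
  proof (rule Bochner_Integration.integrable_bound[OF E(1)])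
    show "AE p in ?M. norm (?g p) \<le> norm (E 1 p)"
    proof (intro AE_I2)
      fix p
      show "norm (?g p) \<le> norm (E 1 p)"
        using nonneg[of p] le[of 1 p] unfolding real_norm_def by linarith
    qed
  qed measurable
  have "integral\<^sup>L ?M ?g \<le> (8 * (A * B\<^sup>2) * (9 * pi * R\<^sup>2)) / N" if "0 < N" for N :: nat
  proof -
    have "integral\<^sup>L ?M ?g \<le> integral\<^sup>L ?M (E N)"
      by (intro integral_mono int E(1) le that)
    with E(2)[of N] show ?thesis
      by linarith
  qed
  moreover have "(\<lambda>N. (8 * (A * B\<^sup>2) * (9 * pi * R\<^sup>2)) / real N) \<longlonglongrightarrow> 0"
    by (rule lim_const_over_n)
  ultimately have "integral\<^sup>L ?M ?g \<le> 0"
    by (intro LIMSEQ_le_const[of _ 0]) (auto intro!: exI[of _ 1])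
  moreover have "0 \<le> integral\<^sup>L ?M ?g"
    using nonneg by (intro integral_nonneg_AE AE_I2)
  ultimately show ?thesis
    using integral_nonneg_eq_0_iff_AE[OF int AE_I2[OF nonneg]] by linarith
qed

lemma energy_vanishes:
  assumes "DIM('a) = 2"
  shows "AE x in lborel. AE y in lborel. (\<sigma> x - \<sigma> y)\<^sup>2 * W x y = 0"
proof -
  \<comment> \<open>The radii \<open>R + n\<close> satisfy the requirement of being at least
    \<open>R\<close>, and the corresponding countably many balls exhaust the space.\<close>
  have "AE p in lborel \<Otimes>\<^sub>M lborel. \<forall>n::nat.
      (case p of (x, y) \<Rightarrow> indicator (ball 0 (R + real n)) x * ((\<sigma> x - \<sigma> y)\<^sup>2 * W x y)) = 0"
    unfolding AE_all_countable using energy_vanishes_on_ball[OF assms] by simp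
  then have "AE p in lborel \<Otimes>\<^sub>M lborel. (case p of (x, y) \<Rightarrow> (\<sigma> x - \<sigma> y)\<^sup>2 * W x y) = 0"
  proof eventually_elim
    case (elim p)
    obtain x y where p: "p = (x, y)"
      by (cases p)
    obtain n :: nat where "norm x < n"
      using reals_Archimedean2 by blast
    then have "x \<in> ball 0 (R + real n)"
      using R_pos by simp
    then show ?case
      using elim[rule_format, of n] by (simp add: p)
  qed
  from lborel_pair.AE_pair[OF this] show ?thesis
    by simp
qed

lemma sigma_locally_constant:
  assumes dim: "DIM('a) = 2" and K_pos: "AE z in lborel. norm z < r \<longrightarrow> 0 < K z"
  shows "AE x in lborel. AE y in lborel. norm (x - y) < r \<longrightarrow> \<sigma> y = \<sigma> x"
  using energy_vanishes[OF dim]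
proof eventually_elim
  case (elim x)
  from elim AE_lborel_reflect[OF K_pos, of x] show ?case
  proof eventually_elim
    case (elim y)
    then show ?case
      using psi_pos[of x] psi_pos[of y] by (auto simp: W_def)
  qed
qed

text \<open>The good points, around which \<open>\<sigma>\<close> is almost everywhere equal to its
  value at the centre, have full measure but need not form a connected set. So
  \<open>\<sigma>\<close> is transferred to a function on the whole space by moving each point to a
  nearby good one; that function is locally constant, hence constant.\<close>

lemma sigma_AE_constant:
  assumes dim: "DIM('a) = 2" and "0 < r" and K_pos: "AE z in lborel. norm z < r \<longrightarrow> 0 < K z"
  shows "\<exists>c. AE x in lborel. \<sigma> x = c"
proof -
  define G where "G = {x. AE y in lborel. norm (x - y) < r \<longrightarrow> \<sigma> y = \<sigma> x}"
  have G: "AE x in lborel. x \<in> G"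
    using sigma_locally_constant[OF dim K_pos] by (simp add: G_def)
  \<comment> \<open>The two balls overlap in an open set around the midpoint, and some point there
    is compatible with both centres.\<close>
  have close: "\<sigma> x = \<sigma> x'" if "x \<in> G" "x' \<in> G" "norm (x - x') < 2 * r" for x x'
  proof -
    let ?U = "ball x r \<inter> ball x' r"
    have "midpoint x x' \<in> ?U"
      using that(3) dist_midpoint[of x x'] by (simp add: dist_commute dist_norm[of x x', symmetric])
    then have "\<exists>y\<in>?U. (norm (x - y) < r \<longrightarrow> \<sigma> y = \<sigma> x) \<and> (norm (x' - y) < r \<longrightarrow> \<sigma> y = \<sigma> x')"
      using that(1,2) by (intro AE_lborel_open_ex) (auto simp: G_def)
    then show ?thesis
      by (auto simp: dist_norm)
  qed
  \<comment> \<open>With displacement below \<open>r / 2\<close> at each end, points at distance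
    below \<open>r\<close> are moved to good points at distance below \<open>2 * r\<close>, as
    \<open>close\<close> requires.\<close>
  define g where "g z = (SOME x. x \<in> G \<and> norm (z - x) < r / 2)" for z
  have g: "g z \<in> G" "norm (z - g z) < r / 2" for z
  proof -
    have "\<exists>x\<in>ball z (r / 2). x \<in> G"
      using \<open>0 < r\<close> by (intro AE_lborel_open_ex[OF G]) auto
    then have "\<exists>x. x \<in> G \<and> norm (z - x) < r / 2"
      by (auto simp: dist_norm)
    from someI_ex[OF this] show "g z \<in> G" "norm (z - g z) < r / 2"
      by (simp_all add: g_def)
  qed
  have "(\<lambda>z. \<sigma> (g z)) constant_on UNIV"
  proof (rule locally_constant_imp_constant)
    fix z :: 'a
    have "\<sigma> (g z') = \<sigma> (g z)" if "z' \<in> ball z r" for z'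
    proof (rule close)
      have "norm (g z' - g z) \<le> norm (z' - g z') + norm (z - z') + norm (z - g z)"
        by norm
      also have "\<dots> < 2 * r"
        using g(2)[of z] g(2)[of z'] that by (simp add: dist_norm)
      finally show "norm (g z' - g z) < 2 * r" .
    qed (rule g)+
    then have "\<forall>x\<in>ball z r. \<sigma> (g x) = \<sigma> (g z)"
      by (intro ballI)
    moreover have "openin (top_of_set UNIV) (ball z r)" "z \<in> ball z r"
      using \<open>0 < r\<close> by (simp_all add: open_openin[symmetric])
    ultimately show "\<exists>T. openin (top_of_set UNIV) T \<and> z \<in> T \<and> (\<forall>x\<in>T. \<sigma> (g x) = \<sigma> (g z))"
      by blast
  qed auto
  then obtain c where c: "\<And>z. \<sigma> (g z) = c"
    by (auto simp: constant_on_def)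
  have "\<sigma> x = c" if "x \<in> G" for x
    using close[OF that g(1)[of x]] g(2)[of x] \<open>0 < r\<close> c by simp
  with G have "AE x in lborel. \<sigma> x = c"
    by (auto elim!: eventually_mono)
  then show ?thesis ..
qed

text \<open>Convolution does not see null sets, so convolving \<open>\<phi> = c * \<psi>\<close>,
  known almost everywhere, gives \<open>a x * \<phi> x = a x * (c * \<psi> x)\<close> at every
  \<open>x\<close>; then divide by \<open>a x\<close>.\<close>

lemma phi_proportional_psi:
  assumes dim: "DIM('a) = 2" and "0 < r" and K_pos: "AE z in lborel. norm z < r \<longrightarrow> 0 < K z"
  shows "\<exists>c. \<forall>x. \<phi> x = c * \<psi> x"
proof -
  obtain c where c: "AE x in lborel. \<sigma> x = c"
    using sigma_AE_constant[OF assms] by blast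
  have "\<phi> x = c * \<psi> x" for x
  proof -
    have "0 < a x * \<psi> x"
      using integral_positive_convolution[OF psi_integrable _ K_nonneg \<open>0 < r\<close> K_pos, of x] psi_pos
      by (simp add: psi_eq)
    then have "a x \<noteq> 0"
      by auto
    have "a x * \<phi> x = (LINT y|lborel. c * (\<psi> y * K (x - y)))"
      unfolding phi_eq[symmetric]
    proof (rule integral_cong_AE)
      show "AE y in lborel. \<phi> y * K (x - y) = c * (\<psi> y * K (x - y))"
        using c by eventually_elim (simp add: sigma_psi[symmetric])
    qed measurable
    also have "\<dots> = a x * (c * \<psi> x)"
      by (simp add: psi_eq)
    finally show ?thesis
      using \<open>a x \<noteq> 0\<close> by simp
  qed
  then show ?thesis
    by blast
qed

end

section \<open>Borel representatives and differentiation of the equation\<close>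

lemma
  fixes f g :: "'a::euclidean_space \<Rightarrow> real"
  assumes g: "g \<in> borel_measurable borel" and ae: "AE x in lborel. f x = g x"
  shows integrable_lebesgue_iff_lborel: "integrable lebesgue f \<longleftrightarrow> integrable lborel g"
    and integral_lebesgue_eq_lborel: "integral\<^sup>L lebesgue f = integral\<^sup>L lborel g"
proof -
  have g': "g \<in> borel_measurable lebesgue"
    using g by (simp add: measurable_completion)
  have ae': "AE x in lebesgue. f x = g x"
    using ae by (rule AE_completion)
  have f': "f \<in> borel_measurable lebesgue"
    using ae' by (intro borel_measurable_AE[OF g']) (simp add: eq_commute)
  show "integrable lebesgue f \<longleftrightarrow> integrable lborel g"
    using integrable_cong_AE[OF f' g' ae'] g by (simp add: integrable_completion)
  show "integral\<^sup>L lebesgue f = integral\<^sup>L lborel g"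
    using integral_cong_AE[OF f' g' ae'] g by (simp add: integral_completion)
qed

text \<open>Changing \<open>w\<close> and \<open>k\<close> on null sets affects only the integral,
  while the value \<open>w x\<close> outside it stays exact. Hence the convolution of a Borel
  representative \<open>w'\<close> still determines \<open>w\<close> itself at every point. The two
  alternatives in \<open>int\<close> serve \<open>\<psi>\<close>, integrable by being a solution,
  and \<open>u\<close>, integrable by boundedness.\<close>

lemma
  fixes k K w w' :: "real^2 \<Rightarrow> real"
  assumes [measurable]: "K \<in> borel_measurable borel" "w' \<in> borel_measurable borel"
    and K: "integrable lborel K" "integral\<^sup>L lborel K = 1"
    and k: "AE z in lborel. k z = K z" and w: "AE y in lborel. w y = w' y"
    and int: "integrable lebesgue (\<lambda>y. (w x - w y) * k (x - y)) \<or> integrable lborel (\<lambda>y. w' y * K (x - y))"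
  shows integrable_convolution: "integrable lborel (\<lambda>y. w' y * K (x - y))"
    and convolution_eq: "(LINT y|lborel. w' y * K (x - y)) = w x - nonlocal_op k w x"
proof -
  have ae: "AE y in lborel. (w x - w y) * k (x - y) = (w x - w' y) * K (x - y)"
    using w AE_lborel_reflect[OF k, of x] by eventually_elim simp
  have Kx: "integrable lborel (\<lambda>y. w x * K (x - y))" "(LINT y|lborel. w x * K (x - y)) = w x"
    using K by (simp_all add: integrable_lborel_reflect integral_lborel_reflect)
  have eq: "w' y * K (x - y) = w x * K (x - y) - (w x - w' y) * K (x - y)" for y
    by (simp add: algebra_simps)
  show int': "integrable lborel (\<lambda>y. w' y * K (x - y))"
    using int
  proof
    assume "integrable lebesgue (\<lambda>y. (w x - w y) * k (x - y))"
    then have "integrable lborel (\<lambda>y. (w x - w' y) * K (x - y))"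
      by (subst (asm) integrable_lebesgue_iff_lborel[OF _ ae]) simp_all
    from Bochner_Integration.integrable_diff[OF Kx(1) this] show ?thesis
      by (simp add: eq[symmetric])
  qed
  have "nonlocal_op k w x = (LINT y|lborel. (w x - w' y) * K (x - y))"
    unfolding nonlocal_op_def by (rule integral_lebesgue_eq_lborel[OF _ ae]) simp
  also have "\<dots> = w x - (LINT y|lborel. w' y * K (x - y))"
    using Bochner_Integration.integral_diff[OF Kx(1) int'] Kx(2) by (simp add: left_diff_distrib)
  finally show "(LINT y|lborel. w' y * K (x - y)) = w x - nonlocal_op k w x"
    by simp
qed

lemma borel_even_kernel:
  fixes k :: "'a::euclidean_space \<Rightarrow> real"
  assumes k: "k \<in> borel_measurable lebesgue" "\<And>z. k (- z) = k z" "\<And>z. 0 \<le> k z"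
    "\<And>z. R \<le> norm z \<Longrightarrow> k z = 0"
  obtains K where "K \<in> borel_measurable borel" "\<And>z. K (- z) = K z" "\<And>z. 0 \<le> K z"
    "\<And>z. R \<le> norm z \<Longrightarrow> K z = 0" "AE z in lborel. k z = K z"
proof -
  obtain K0 where K0: "K0 \<in> borel_measurable lborel" and ae: "AE z in lborel. k z = K0 z"
    using completion_ex_borel_measurable_real[OF k(1)] by auto
  have [measurable]: "K0 \<in> borel_measurable borel" "ball (0::'a) R \<in> sets borel"
    using K0 by simp_all
  \<comment> \<open>Symmetrizing, taking the positive part and cutting off outside the ball each
    leave \<open>k\<close> unchanged, so equality almost everywhere survives while the exact
    properties are restored everywhere.\<close>
  define K where "K z = indicator (ball 0 R) z * max 0 ((K0 z + K0 (- z)) / 2)" for z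
  show thesis
  proof
    show "K \<in> borel_measurable borel"
      unfolding K_def by measurable
    show "K (- z) = K z" for z
      by (simp add: K_def indicator_def add.commute)
    show "0 \<le> K z" for z
      by (simp add: K_def)
    show "K z = 0" if "R \<le> norm z" for z
      using that by (simp add: K_def)
    show "AE z in lborel. k z = K z"
      using ae AE_lborel_reflect[OF ae, of 0]
    proof eventually_elim
      case (elim z)
      then show ?case
        using k(2-4)[of z] by (cases "norm z < R") (simp_all add: K_def)
    qed
  qed
qed

text \<open>Differentiate \<open>eq\<close> in direction \<open>e\<close>: difference quotients of
  \<open>u\<close> are bounded by \<open>B\<close> through the mean value theorem, so dominated
  convergence passes to the limit under the integral, and the right-hand side follows from the chain
  rule.\<close>

lemma integral_convolution_derivative:
  fixes K u p :: "'a::euclidean_space \<Rightarrow> real" and g :: "real \<Rightarrow> real"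
  assumes [measurable]: "K \<in> borel_measurable borel" "p \<in> borel_measurable borel"
    and K: "integrable lborel K"
    and u: "\<And>x. (u has_derivative u' x) (at x)" and p: "\<And>x. u' x e = p x"
    and u_bound: "\<And>x. \<bar>u x\<bar> \<le> C" and p_bound: "\<And>x. \<bar>p x\<bar> \<le> B"
    and g: "(g has_real_derivative g') (at (u x))"
    and eq: "\<And>x. (LINT y|lborel. u y * K (x - y)) = g (u x)"
  shows "(LINT y|lborel. p y * K (x - y)) = g' * p x"
proof -
  have "continuous_on UNIV u"
    by (intro continuous_at_imp_continuous_on ballI has_derivative_continuous[OF u])
  then have [measurable]: "u \<in> borel_measurable borel"
    by (rule borel_measurable_continuous_onI)
  have line: "((\<lambda>t. u (x + t *\<^sub>R e)) has_real_derivative p (x + t *\<^sub>R e)) (at t)" for x t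
  proof -
    have "((\<lambda>t. u (x + t *\<^sub>R e)) has_derivative (\<lambda>h. u' (x + t *\<^sub>R e) (h *\<^sub>R e))) (at t)"
      by (rule has_derivative_compose[OF _ u]) (auto intro!: derivative_eq_intros)
    then show ?thesis
      unfolding has_field_derivative_def linear_cmul[OF has_derivative_linear[OF u]] p
      by (simp add: mult_commute_abs)
  qed
  define q where "q n = inverse (real (Suc n))" for n
  have q_pos: "0 < q n" for n
    by (simp add: q_def)
  have "q \<longlonglongrightarrow> 0"
    using LIMSEQ_inverse_real_of_nat by (simp only: q_def[abs_def])
  then have q_lim: "filterlim q (at 0) sequentially"
    using q_pos by (auto simp: filterlim_at less_imp_neq[symmetric])
  define s where "s n z = (u (z + q n *\<^sub>R e) - u z) / q n" for n z
  have s_bound: "\<bar>s n z\<bar> \<le> B" for n z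
  proof -
    obtain t where "u (z + q n *\<^sub>R e) - u (z + 0 *\<^sub>R e) = (q n - 0) * p (z + t *\<^sub>R e)"
      using MVT2[OF q_pos[of n] line] by blast
    then have "s n z = p (z + t *\<^sub>R e)"
      using q_pos[of n] by (simp add: s_def)
    then show ?thesis
      using p_bound by simp
  qed
  have quotient: "(\<lambda>n. (v (q n) - v 0) / q n) \<longlonglongrightarrow> D" if "(v has_real_derivative D) (at 0)" for v D
    using filterlim_compose[OF that[unfolded DERIV_def] q_lim] by simp
  have s_lim: "(\<lambda>n. s n z) \<longlonglongrightarrow> p z" for z
    using quotient[OF line[of z 0, unfolded scaleR_zero_left add_0_right]] by (simp add: s_def)
  have [measurable]: "s n \<in> borel_measurable borel" for n
    unfolding s_def by measurable
  \<comment> \<open>Reflecting the variable puts the dependence on \<open>x\<close> into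
    \<open>w\<close>, so that difference quotients fall on \<open>u\<close> and never on the
    possibly discontinuous kernel.\<close>
  have shift: "(LINT y|lborel. w y * K (x - y)) = (LINT z|lborel. w (x - z) * K z)"
    if [measurable]: "w \<in> borel_measurable borel" for w x
    using integral_lborel_reflect[of "\<lambda>z. w (x - z) * K z" x] by simp
  have "(\<lambda>n. LINT z|lborel. s n (x - z) * K z) \<longlonglongrightarrow> (LINT z|lborel. p (x - z) * K z)"
  proof (rule integral_dominated_convergence)
    show "integrable lborel (\<lambda>z. B * \<bar>K z\<bar>)"
      using K by simp
    show "AE z in lborel. (\<lambda>n. s n (x - z) * K z) \<longlonglongrightarrow> p (x - z) * K z"
      by (intro AE_I2 tendsto_mult s_lim tendsto_const)
    show "AE z in lborel. norm (s n (x - z) * K z) \<le> B * \<bar>K z\<bar>" for n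
      using s_bound by (intro AE_I2) (simp add: abs_mult mult_right_mono)
  qed measurable
  moreover have "(LINT z|lborel. s n (x - z) * K z) = (g (u (x + q n *\<^sub>R e)) - g (u x)) / q n" for n
  proof -
    have i: "integrable lborel (\<lambda>z. u (y - z) * K z)" for y
    proof (rule Bochner_Integration.integrable_bound)
      show "integrable lborel (\<lambda>z. C * \<bar>K z\<bar>)"
        using K by simp
      show "AE z in lborel. norm (u (y - z) * K z) \<le> norm (C * \<bar>K z\<bar>)"
      proof (intro AE_I2)
        fix z
        have "\<bar>u (y - z)\<bar> * \<bar>K z\<bar> \<le> \<bar>C\<bar> * \<bar>K z\<bar>"
          using u_bound[of "y - z"] by (intro mult_right_mono) auto
        then show "norm (u (y - z) * K z) \<le> norm (C * \<bar>K z\<bar>)"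
          by (simp add: abs_mult)
      qed
    qed measurable
    have "(LINT z|lborel. s n (x - z) * K z)
        = (LINT z|lborel. (u ((x + q n *\<^sub>R e) - z) * K z - u (x - z) * K z) / q n)"
      by (simp add: s_def algebra_simps diff_divide_distrib)
    also have "\<dots> = ((LINT z|lborel. u ((x + q n *\<^sub>R e) - z) * K z) - (LINT z|lborel. u (x - z) * K z)) / q n"
      using i by simp
    finally show ?thesis
      by (simp add: shift[symmetric] eq)
  qed
  moreover have "(\<lambda>n. (g (u (x + q n *\<^sub>R e)) - g (u x)) / q n) \<longlonglongrightarrow> g' * p x"
    using quotient[OF DERIV_chain2[OF _ line[of x 0]], of g g'] g by simp
  ultimately show ?thesis
    using LIMSEQ_unique shift[of p x] by force
qed

section \<open>One-dimensionality from a gradient of fixed direction\<close>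

text \<open>On the line through two points with the same value of
  \<open>\<omega> \<bullet> x\<close>, the derivative of \<open>u\<close> is zero. The argument
  includes \<open>\<omega> = 0\<close>, where \<open>u\<close> is constant.\<close>

lemma one_dimensionalI:
  assumes u: "\<And>x. (u has_derivative (\<lambda>v. (\<omega> \<bullet> v) * \<psi> x)) (at x)"
  shows "one_dimensional u"
proof -
  have level: "u x = u y" if "\<omega> \<bullet> x = \<omega> \<bullet> y" for x y
  proof -
    have "((\<lambda>t. u (x + t *\<^sub>R (y - x))) has_derivative
        (\<lambda>h. (\<omega> \<bullet> (h *\<^sub>R (y - x))) * \<psi> (x + t *\<^sub>R (y - x)))) (at t)" for t
      by (rule has_derivative_compose[OF _ u]) (auto intro!: derivative_eq_intros)
    then have "\<forall>t. ((\<lambda>t. u (x + t *\<^sub>R (y - x))) has_real_derivative 0) (at t)"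
      using that by (simp add: has_field_derivative_def inner_diff_right lambda_zero)
    from DERIV_isconst_all[OF this, of 0 1] show ?thesis
      by simp
  qed
  \<comment> \<open>The profile evaluates \<open>u\<close> at an arbitrarily chosen point of the
    level set; values not attained by \<open>\<omega> \<bullet> x\<close> are never queried.\<close>
  have "u x = u (SOME y. \<omega> \<bullet> y = \<omega> \<bullet> x)" for x
    using someI[of "\<lambda>y. \<omega> \<bullet> y = \<omega> \<bullet> x" x] by (intro level) simp
  then show ?thesis
    unfolding one_dimensional_def by (intro exI[of _ "\<lambda>s. u (SOME y. \<omega> \<bullet> y = s)"] exI[of _ \<omega>]) simp
qed

theorem theorem3:
  fixes k u :: "real^2 \<Rightarrow> real"
    and f :: "real \<Rightarrow> real"
    and m\<^sub>0 M\<^sub>0 r\<^sub>0 R\<^sub>0 :: real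
  assumes k_meas: "k \<in> borel_measurable lebesgue"
    and k_even: "\<And>\<zeta>. k (- \<zeta>) = k \<zeta>"
    and k_int: "(LINT \<zeta>|lebesgue. k \<zeta>) = 1"
    and bounds: "0 < m\<^sub>0" "m\<^sub>0 \<le> M\<^sub>0" "0 < r\<^sub>0" "r\<^sub>0 \<le> R\<^sub>0"
    and k_lower: "\<And>\<zeta>. m\<^sub>0 * indicator (ball 0 r\<^sub>0) \<zeta> \<le> k \<zeta>"
    and k_upper: "\<And>\<zeta>. k \<zeta> \<le> M\<^sub>0 * indicator (ball 0 R\<^sub>0) \<zeta>"
    and f_C1: "f C1_differentiable_on UNIV"
    and u_C1: "finite_C1_norm u"
    and u_sol: "\<And>x. nonlocal_op k u x = f (u x)"
    and psi: "\<exists>\<psi>. (\<forall>x. 0 < \<psi> x) \<and> nonlocal_solution k \<psi> (\<lambda>x. deriv f (u x) * \<psi> x)"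
  shows "one_dimensional u"
proof -
  have k_nonneg: "0 \<le> k z" for z
    using k_lower[of z] bounds by (cases "z \<in> ball 0 r\<^sub>0") auto
  have k_support: "k z = 0" if "R\<^sub>0 \<le> norm z" for z
    using k_upper[of z] k_nonneg[of z] that by simp
  obtain K where K: "K \<in> borel_measurable borel" "\<And>z. K (- z) = K z" "\<And>z. 0 \<le> K z"
      "\<And>z. R\<^sub>0 \<le> norm z \<Longrightarrow> K z = 0" and kK: "AE z in lborel. k z = K z"
    using borel_even_kernel[OF k_meas k_even k_nonneg k_support] by blast
  note [measurable] = K(1)
  \<comment> \<open>A non-integrable function would have integral 0 by convention, contradicting the
    value 1.\<close>
  have "integrable lebesgue k"
    using k_int not_integrable_integral_eq by force
  then have K_int: "integrable lborel K" and K_one: "integral\<^sup>L lborel K = 1"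
    using integrable_lebesgue_iff_lborel[OF K(1) kK] integral_lebesgue_eq_lborel[OF K(1) kK] k_int by auto
  have K_pos: "AE z in lborel. norm z < r\<^sub>0 \<longrightarrow> 0 < K z"
    using kK
  proof eventually_elim
    case (elim z)
    then show ?case
      using k_lower[of z] bounds by auto
  qed
  obtain f' where f': "\<And>s. (f has_real_derivative f' s) (at s)" and f'_cont: "continuous_on UNIV f'"
    using f_C1 unfolding C1_differentiable_on_def has_real_derivative_iff_has_vector_derivative by auto
  have deriv_f: "deriv f s = f' s" for s
    using f' by (rule DERIV_imp_deriv)
  define a where "a x = 1 - f' (u x)" for x
  have Du: "(u has_derivative frechet_derivative u (at x)) (at x)" for x
    using u_C1 by (simp add: finite_C1_norm_def C1_plane_def frechet_derivative_works)
  have "continuous_on UNIV u"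
    by (intro continuous_at_imp_continuous_on ballI has_derivative_continuous[OF Du])
  then have u_borel [measurable]: "u \<in> borel_measurable borel"
    by (rule borel_measurable_continuous_onI)
  have f'_borel [measurable]: "f' \<in> borel_measurable borel"
    using f'_cont by (rule borel_measurable_continuous_onI)
  have a_borel [measurable]: "a \<in> borel_measurable borel"
    unfolding a_def by measurable
  obtain C where C: "\<And>x. \<bar>u x\<bar> \<le> C"
    using u_C1 by (auto simp: finite_C1_norm_def bounded_iff)
  \<comment> \<open>The range of \<open>u\<close> lies in this compact interval, on which the
    continuous \<open>f'\<close> is bounded; this yields the upper bound for
    \<open>a\<close>.\<close>
  have "compact (f' ` {-C..C})"
    using f'_cont by (intro compact_continuous_image) (auto intro: continuous_on_subset)
  then obtain C' where "\<forall>y\<in>f' ` {-C..C}. norm y \<le> C'"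
    using compact_imp_bounded bounded_iff by blast
  then have C': "\<bar>f' s\<bar> \<le> C'" if "s \<in> {-C..C}" for s
    using that by auto
  have a_le: "a x \<le> 1 + C'" for x
    using C'[of "u x"] C[of x] by (auto simp: a_def abs_le_iff)
  have u_int: "integrable lborel (\<lambda>y. u y * K (x - y))" for x
  proof (rule Bochner_Integration.integrable_bound)
    show "integrable lborel (\<lambda>y. C * K (x - y))"
      using K_int by (simp add: integrable_lborel_reflect)
    show "AE y in lborel. norm (u y * K (x - y)) \<le> norm (C * K (x - y))"
    proof (intro AE_I2)
      fix y
      have "\<bar>u y\<bar> * \<bar>K (x - y)\<bar> \<le> \<bar>C\<bar> * \<bar>K (x - y)\<bar>"
        using C[of y] by (intro mult_right_mono) auto
      then show "norm (u y * K (x - y)) \<le> norm (C * K (x - y))"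
        by (simp add: abs_mult)
    qed
  qed measurable
  have u_eq: "(LINT y|lborel. u y * K (x - y)) = u x - f (u x)" for x
    using convolution_eq[OF K(1) u_borel K_int K_one kK, of u] u_int u_sol by simp
  obtain \<psi> where \<psi>_pos: "\<And>x. 0 < \<psi> x"
    and \<psi>_sol: "nonlocal_solution k \<psi> (\<lambda>x. deriv f (u x) * \<psi> x)"
    using psi by blast
  then obtain \<psi>' where \<psi>': "\<psi>' \<in> borel_measurable lborel" and \<psi>\<psi>': "AE x in lborel. \<psi> x = \<psi>' x"
    using completion_ex_borel_measurable_real[of \<psi> lborel] by (auto simp: nonlocal_solution_def)
  have \<psi>'_borel [measurable]: "\<psi>' \<in> borel_measurable borel"
    using \<psi>' by simp
  \<comment> \<open>The representative \<open>\<psi>'\<close> stands inside the integral, but the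
    right-hand side contains the original \<open>\<psi> x\<close>.\<close>
  have \<psi>'_int: "integrable lborel (\<lambda>y. \<psi>' y * K (x - y))"
    and \<psi>'_eq: "(LINT y|lborel. \<psi>' y * K (x - y)) = a x * \<psi> x" for x
    using integrable_convolution[OF K(1) \<psi>'_borel K_int K_one kK \<psi>\<psi>', of x]
      convolution_eq[OF K(1) \<psi>'_borel K_int K_one kK \<psi>\<psi>', of x] \<psi>_sol
    by (auto simp: nonlocal_solution_def deriv_f a_def algebra_simps)
  have "AE y in lborel. 0 < \<psi>' y"
    using \<psi>\<psi>' by eventually_elim (metis \<psi>_pos)
  from integral_positive_convolution[OF \<psi>'_int this K(3) \<open>0 < r\<^sub>0\<close> K_pos]
  have "a x \<noteq> 0" for x
    by (metis \<psi>'_eq less_irrefl mult_zero_left)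
  then have "\<psi> = (\<lambda>x. (LINT y|lborel. \<psi>' y * K (x - y)) / a x)"
    by (simp add: \<psi>'_eq)
  also have "\<dots> \<in> borel_measurable borel"
    by measurable
  finally have \<psi>_borel [measurable]: "\<psi> \<in> borel_measurable borel" .
  \<comment> \<open>Now that \<open>\<psi>\<close> is known to be Borel, it serves as its own
    representative, and the equation holds for it everywhere.\<close>
  have \<psi>_int: "integrable lborel (\<lambda>y. \<psi> y * K (x - y))"
    and \<psi>_eq: "(LINT y|lborel. \<psi> y * K (x - y)) = a x * \<psi> x" for x
    using integrable_convolution[OF K(1) \<psi>_borel K_int K_one kK, of \<psi> x]
      convolution_eq[OF K(1) \<psi>_borel K_int K_one kK, of \<psi> x] \<psi>_sol
    by (auto simp: nonlocal_solution_def deriv_f a_def algebra_simps)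
  have "\<exists>c. \<forall>x. partial_deriv i u x = c * \<psi> x" for i
  proof -
    have cont: "continuous_on UNIV (partial_deriv i u)"
      using u_C1 by (simp add: finite_C1_norm_def C1_plane_def)
    then have p_borel: "partial_deriv i u \<in> borel_measurable borel"
      by (rule borel_measurable_continuous_onI)
    have "bounded (range (partial_deriv i u))"
      using u_C1 by (simp add: finite_C1_norm_def)
    then obtain B where B: "\<And>x. \<bar>partial_deriv i u x\<bar> \<le> B"
      by (auto simp: bounded_iff)
    have p_eq: "(LINT y|lborel. partial_deriv i u y * K (x - y)) = a x * partial_deriv i u x" for x
    proof (rule integral_convolution_derivative[OF K(1) p_borel K_int Du _ C B _ u_eq])
      \<comment> \<open>The convolution form of the equation for \<open>u\<close> has right-hand
        side \<open>g (u x)\<close> with \<open>g s = s - f s\<close>, and the derivative of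
        \<open>g\<close> at \<open>u x\<close> is exactly \<open>a x\<close>.\<close>
      show "((\<lambda>s. s - f s) has_real_derivative a x) (at (u x))"
        unfolding a_def by (intro derivative_intros f')
    qed (simp add: partial_deriv_def)
    interpret linearized_equation K "partial_deriv i u" \<psi> a R\<^sub>0 "1 + C'" B
      using K K_int bounds by unfold_locales
        (auto intro: p_borel B \<psi>_borel \<psi>_pos a_borel a_le \<psi>_int \<psi>_eq p_eq)
    show ?thesis
      using \<open>0 < r\<^sub>0\<close> K_pos by (intro phi_proportional_psi) auto
  qed
  then obtain c where c: "\<And>i x. partial_deriv i u x = c i * \<psi> x"
    by metis
  \<comment> \<open>The proportionality constants of the partial derivatives are the components of
    the direction \<open>\<omega>\<close>.\<close>
  have "frechet_derivative u (at x) v = ((\<chi> i. c i) \<bullet> v) * \<psi> x" for x v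
  proof -
    let ?D = "frechet_derivative u (at x)"
    have lin: "linear ?D"
      using Du by (rule has_derivative_linear)
    have "?D v = ?D (\<Sum>i\<in>UNIV. v $ i *\<^sub>R axis i 1)"
      by (simp add: basis_expansion scalar_mult_eq_scaleR[symmetric])
    also have "\<dots> = (\<Sum>i\<in>UNIV. v $ i * partial_deriv i u x)"
      by (simp add: linear_sum[OF lin] linear_cmul[OF lin] partial_deriv_def)
    also have "\<dots> = ((\<chi> i. c i) \<bullet> v) * \<psi> x"
      by (simp add: c inner_vec_def sum_distrib_left mult_ac)
    finally show ?thesis .
  qed
  then have "frechet_derivative u (at x) = (\<lambda>v. ((\<chi> i. c i) \<bullet> v) * \<psi> x)" for x
    by (intro ext)
  with Du have "(u has_derivative (\<lambda>v. ((\<chi> i. c i) \<bullet> v) * \<psi> x)) (at x)" for x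
    by (simp only:)
  then show ?thesis
    by (rule one_dimensionalI)
qed


end
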